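(* For any topoframe $L_\tau=(L,\tau)$, $\tau$ is an extremally disconnected frame if and only if $L_\tau$ is an extremally disconnected topoframe.
   Context: A frame is a complete lattice $L$ (top $\top$, bottom $\bot$) with $a\wedge\bigvee S=\bigvee\{a\wedge s: s\in S\}$ for all $a\in L$, $S\subseteq L$. A topoframe $L_\tau$ is a pair $(L,\tau)$ where $L$ is a frame and $\tau$ is a subframe of $L$ (closed under finite meets including $\top$ and arbitrary joins including $\bot$, computed in $L$) all of whose elements are complemented in $L$. The complement in $L$ of a complemented element $a$ is denoted $a'$, and $\tau'=\{t': t\in\tau\}$. A frame $M$ is extremally disconnected if $a^{**}\vee a^*=\top$ for all $a\in M$, where $a^*=\bigvee\{x\in M: x\wedge a=\bot\}$ is the pseudocomplement in $M$ (so for $M=\tau$ the pseudocomplement is formed in $\tau$). The closure of $p\in L$ in $L_\tau$ is $\overline{p}=\bigwedge\{x\in\tau': p\le x\}$. The topoframe $L_\tau$ is extremally disconnected if $\overline a\in\tau$ for all $a\in\tau$. *)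

theory Defs
  imports "HOL-Algebra.Complete_Lattice"
begin

locale frame = complete_lattice L for L (structure) +
  assumes meet_sup_distrib:
    "\<lbrakk>a \<in> carrier L; S \<subseteq> carrier L\<rbrakk> \<Longrightarrow> a \<sqinter> \<Squnion>S = \<Squnion>{a \<sqinter> s | s. s \<in> S}"

locale subframe =
  fixes M :: "'a set" and L (structure)
  assumes subset: "M \<subseteq> carrier L"
    and top_mem: "\<top> \<in> M"
    and bottom_mem: "\<bottom> \<in> M"
    and meet_mem: "\<lbrakk>x \<in> M; y \<in> M\<rbrakk> \<Longrightarrow> x \<sqinter> y \<in> M"
    and sup_mem: "S \<subseteq> M \<Longrightarrow> \<Squnion>S \<in> M"

definition is_complement :: "('a, 'b) gorder_scheme \<Rightarrow> 'a \<Rightarrow> 'a \<Rightarrow> bool" where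
  "is_complement L a b \<longleftrightarrow>
     a \<in> carrier L \<and> b \<in> carrier L \<and> a \<sqinter>\<^bsub>L\<^esub> b = \<bottom>\<^bsub>L\<^esub> \<and> a \<squnion>\<^bsub>L\<^esub> b = \<top>\<^bsub>L\<^esub>"

definition complemented :: "('a, 'b) gorder_scheme \<Rightarrow> 'a \<Rightarrow> bool" where
  "complemented L a \<longleftrightarrow> (\<exists>b. is_complement L a b)"

text \<open>Complements in a frame are unique (lemma \<open>is_complement_unique\<close> below), so the
  description is proper whenever \<open>a\<close> is complemented.\<close>

definition complement :: "('a, 'b) gorder_scheme \<Rightarrow> 'a \<Rightarrow> 'a" where
  "complement L a = (THE b. is_complement L a b)"

definition pseudocomplement :: "('a, 'b) gorder_scheme \<Rightarrow> 'a \<Rightarrow> 'a" where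
  "pseudocomplement L a = \<Squnion>\<^bsub>L\<^esub>{x \<in> carrier L. x \<sqinter>\<^bsub>L\<^esub> a = \<bottom>\<^bsub>L\<^esub>}"

locale extremally_disconnected_frame = frame +
  assumes pseudocomplement_join_top:
    "a \<in> carrier L \<Longrightarrow>
       pseudocomplement L (pseudocomplement L a) \<squnion> pseudocomplement L a = \<top>"

locale topoframe = frame L + subframe \<tau> L for L (structure) and \<tau> +
  assumes tau_complemented: "t \<in> \<tau> \<Longrightarrow> complemented L t"

definition topoframe_closure :: "('a, 'b) gorder_scheme \<Rightarrow> 'a set \<Rightarrow> 'a \<Rightarrow> 'a" where
  "topoframe_closure L \<tau> p = \<Sqinter>\<^bsub>L\<^esub>{x \<in> complement L ` \<tau>. p \<sqsubseteq>\<^bsub>L\<^esub> x}"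

locale extremally_disconnected_topoframe = topoframe +
  assumes closure_mem: "a \<in> \<tau> \<Longrightarrow> topoframe_closure L \<tau> a \<in> \<tau>"

lemma (in frame) join_le_of_meet:
  assumes x: "x \<in> carrier L" and a: "a \<in> carrier L" and b: "b \<in> carrier L" and c: "c \<in> carrier L"
    and "a \<squnion> b = \<top>" and "x \<sqinter> a \<sqsubseteq> c" and "x \<sqinter> b \<sqsubseteq> c"
  shows "x \<sqsubseteq> c"
proof -
  have "x = x \<sqinter> \<Squnion>{a, b}"
    using assms(5) x by (metis join_def le_antisym meet_closed meet_le meet_left
        top_closed top_higher le_refl)
  also have "\<dots> = \<Squnion>{x \<sqinter> s | s. s \<in> {a, b}}"
    using a b x by (intro meet_sup_distrib) auto
  also have "\<dots> \<sqsubseteq> c"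
    using assms by (intro sup_least) auto
  finally show ?thesis .
qed

lemma (in frame) is_complement_unique:
  assumes "is_complement L a b" and "is_complement L a c"
  shows "b = c"
proof -
  have le: "b \<sqsubseteq> c" if "is_complement L a b" and "is_complement L a c" for b c
  proof (rule join_le_of_meet[of b a c])
    show "b \<sqinter> a \<sqsubseteq> c"
      using that unfolding is_complement_def by (metis bottom_lower meet_comm)
  qed (use that in \<open>auto simp: is_complement_def meet_right\<close>)
  show ?thesis
    using le[OF assms] le[OF assms(2,1)] assms by (auto simp: is_complement_def intro: le_antisym)
qed

text \<open>A subframe \<open>M\<close> of \<open>L\<close>, as a frame in its own right, is the record
  \<open>L\<lparr>carrier := M\<rparr>\<close>; its finite meets and arbitrary joins are those of \<open>L\<close>.\<close>

locale frame_subframe = frame L + subframe M L for L (structure) and M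
begin

abbreviation "LM \<equiv> L\<lparr>carrier := M\<rparr>"

lemma partial_order_sub: "partial_order LM"
proof -
  have 1: "x \<in> M \<Longrightarrow> x \<in> carrier L" for x using subset by blast
  show ?thesis
    by unfold_locales (auto simp: eq_is_equal dest!: 1 intro: le_trans le_antisym)
qed

lemma least_Upper_sub:
  assumes "S \<subseteq> M"
  shows "least LM (\<Squnion>S) (Upper LM S)"
proof -
  have S: "S \<subseteq> carrier L" using assms subset by blast
  show ?thesis
    using assms S subset sup_mem[OF assms] sup_upper[OF S]
    by (auto simp: least_def Upper_def intro!: sup_least)
qed

lemma sup_sub:
  assumes "S \<subseteq> M"
  shows "\<Squnion>\<^bsub>LM\<^esub>S = \<Squnion>S"
proof -
  interpret M: partial_order LM by (rule partial_order_sub)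
  have "least LM (\<Squnion>\<^bsub>LM\<^esub>S) (Upper LM S)"
    unfolding Lattice.sup_def[of LM] by (rule someI) (rule least_Upper_sub[OF assms])
  then show ?thesis
    using M.least_unique least_Upper_sub[OF assms] by blast
qed

lemma complete_lattice_sub: "complete_lattice LM"
proof -
  interpret M: partial_order LM by (rule partial_order_sub)
  show ?thesis
  proof unfold_locales
    fix A assume A: "A \<subseteq> carrier LM"
    then show "\<exists>s. least LM s (Upper LM A)" using least_Upper_sub by auto
    let ?B = "Lower LM A"
    have B: "?B \<subseteq> M" "?B \<subseteq> carrier L" using subset by (auto simp: Lower_def)
    have "greatest LM (\<Squnion>?B) ?B"
      using A B subset sup_mem[OF B(1)] sup_upper[OF B(2)]
      by (auto simp: greatest_def Lower_def intro!: sup_least)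
    then show "\<exists>i. greatest LM i ?B" by blast
  qed
qed

lemma meet_sub:
  assumes "x \<in> M" "y \<in> M"
  shows "x \<sqinter>\<^bsub>LM\<^esub> y = x \<sqinter> y"
proof -
  interpret M: complete_lattice LM by (rule complete_lattice_sub)
  have c: "x \<in> carrier L" "y \<in> carrier L" using assms subset by auto
  have m: "x \<sqinter>\<^bsub>LM\<^esub> y \<in> M" using assms M.meet_closed by auto
  show ?thesis
  proof (rule le_antisym)
    show "x \<sqinter>\<^bsub>LM\<^esub> y \<sqsubseteq> x \<sqinter> y"
      using assms c m M.meet_left[of x y] M.meet_right[of x y] subset by (auto intro!: meet_le)
    show "x \<sqinter> y \<sqsubseteq> x \<sqinter>\<^bsub>LM\<^esub> y"
      using M.meet_le[of "x \<sqinter> y" x y] assms c meet_mem[OF assms] meet_left meet_right by auto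
  qed (use m c subset in auto)
qed

lemma frame_sub: "frame LM"
proof -
  interpret M: complete_lattice LM by (rule complete_lattice_sub)
  show ?thesis
  proof unfold_locales
    fix a S assume "a \<in> carrier LM" "S \<subseteq> carrier LM"
    then have aS: "a \<in> M" "S \<subseteq> M" by auto
    have eq: "{a \<sqinter>\<^bsub>LM\<^esub> s | s. s \<in> S} = {a \<sqinter> s | s. s \<in> S}"
      using aS meet_sub by (metis (no_types, lifting) subsetD)
    have sub: "{a \<sqinter> s | s. s \<in> S} \<subseteq> M" using aS meet_mem by auto
    have "a \<sqinter>\<^bsub>LM\<^esub> \<Squnion>\<^bsub>LM\<^esub>S = a \<sqinter> \<Squnion>S"
      using aS by (simp add: sup_sub meet_sub sup_mem)
    also have "\<dots> = \<Squnion>{a \<sqinter> s | s. s \<in> S}"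
      using aS subset by (intro meet_sup_distrib) auto
    also have "\<dots> = \<Squnion>\<^bsub>LM\<^esub>{a \<sqinter>\<^bsub>LM\<^esub> s | s. s \<in> S}"
      by (simp only: eq sup_sub[OF sub])
    finally show "a \<sqinter>\<^bsub>LM\<^esub> \<Squnion>\<^bsub>LM\<^esub>S = \<Squnion>\<^bsub>LM\<^esub>{a \<sqinter>\<^bsub>LM\<^esub> s | s. s \<in> S}" .
  qed
qed

end

end

theory Submission
  imports Defs
begin

text \<open>For \<open>a\<close> and \<open>t\<close> in \<open>\<tau>\<close>, both \<open>a \<sqsubseteq> t'\<close> and \<open>t \<sqsubseteq> a\<^sup>*\<close> (pseudocomplement
  in \<open>\<tau>\<close>) say that \<open>a\<close> and \<open>t\<close> are disjoint. Complementation reverses the order, so the largest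
  \<open>t \<in> \<tau>\<close> disjoint from \<open>a\<close>, which is \<open>a\<^sup>*\<close>, gives the smallest element of \<open>\<tau>'\<close> above
  \<open>a\<close>: the closure of \<open>a\<close> is \<open>(a\<^sup>*)'\<close> (lemma \<open>closure_eq_complement\<close>). Hence the topoframe
  is extremally disconnected iff every \<open>a\<^sup>*\<close> has its complement in \<open>\<tau>\<close>. A complement of
  \<open>a\<^sup>*\<close> that lies in \<open>\<tau>\<close> must be \<open>a\<^sup>*\<^sup>*\<close>, and \<open>a\<^sup>*\<^sup>*\<close> is always disjoint from
  \<open>a\<^sup>*\<close>; so this happens exactly when \<open>a\<^sup>*\<^sup>* \<squnion> a\<^sup>* = \<top>\<close>.\<close>

context frame
begin

lemma complement_eq: "is_complement L a b \<Longrightarrow> complement L a = b"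
  unfolding complement_def by (blast intro: is_complement_unique)

lemma complemented_is_complement: "complemented L a \<Longrightarrow> is_complement L a (complement L a)"
  unfolding complemented_def using complement_eq by blast

lemma le_bottom_eq: "x \<in> carrier L \<Longrightarrow> x \<sqsubseteq> \<bottom> \<Longrightarrow> x = \<bottom>"
  using bottom_lower le_antisym by blast

text \<open>If \<open>a\<close> is disjoint from \<open>t\<close>, then \<open>a = (a \<sqinter> t) \<squnion> (a \<sqinter> c) = a \<sqinter> c\<close>. The lemma
  trades the order on complements for disjointness, which is what defines pseudocomplements.\<close>

lemma le_complement_iff:
  assumes "is_complement L t c" and a: "a \<in> carrier L"
  shows "a \<sqsubseteq> c \<longleftrightarrow> t \<sqinter> a = \<bottom>"
proof -
  have t: "t \<in> carrier L" and c: "c \<in> carrier L" and tc: "t \<sqinter> c = \<bottom>" "t \<squnion> c = \<top>"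
    using assms by (auto simp: is_complement_def)
  show ?thesis
  proof
    assume "a \<sqsubseteq> c"
    then have "t \<sqinter> a \<sqsubseteq> t \<sqinter> c"
      using a c t by (meson le_trans meet_closed meet_le meet_left meet_right)
    then show "t \<sqinter> a = \<bottom>"
      using a t tc by (simp add: le_bottom_eq)
  next
    assume "t \<sqinter> a = \<bottom>"
    then have "a \<sqinter> t \<sqsubseteq> c" using c by (simp add: meet_comm)
    then show "a \<sqsubseteq> c"
      using join_le_of_meet[OF a t c c tc(2)] a c meet_right by blast
  qed
qed

end

context frame_subframe
begin

lemma in_carrier: "x \<in> M \<Longrightarrow> x \<in> carrier L"
  using subset by blast

lemma join_sub: "x \<in> M \<Longrightarrow> y \<in> M \<Longrightarrow> x \<squnion>\<^bsub>LM\<^esub> y = x \<squnion> y"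
  unfolding join_def by (rule sup_sub) simp

lemma bottom_sub: "\<bottom>\<^bsub>LM\<^esub> = \<bottom>"
proof -
  interpret M: complete_lattice LM by (rule complete_lattice_sub)
  have "\<bottom>\<^bsub>LM\<^esub> \<in> M" using M.bottom_closed by simp
  moreover have "\<bottom>\<^bsub>LM\<^esub> \<sqsubseteq> \<bottom>" using M.bottom_lower[of \<bottom>] bottom_mem by simp
  ultimately show ?thesis using in_carrier le_bottom_eq by blast
qed

lemma top_sub: "\<top>\<^bsub>LM\<^esub> = \<top>"
proof -
  interpret M: complete_lattice LM by (rule complete_lattice_sub)
  have "\<top>\<^bsub>LM\<^esub> \<in> M" using M.top_closed by simp
  moreover have "\<top> \<sqsubseteq> \<top>\<^bsub>LM\<^esub>" using M.top_higher[of \<top>] top_mem by simp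
  ultimately show ?thesis using in_carrier le_antisym top_higher top_closed by blast
qed

lemma pseudocomplement_sub:
  assumes "a \<in> M"
  shows "pseudocomplement LM a = \<Squnion>{x \<in> M. x \<sqinter> a = \<bottom>}"
proof -
  have "{x \<in> carrier LM. x \<sqinter>\<^bsub>LM\<^esub> a = \<bottom>\<^bsub>LM\<^esub>} = {x \<in> M. x \<sqinter> a = \<bottom>}"
    using assms by (auto simp: meet_sub bottom_sub)
  then show ?thesis
    unfolding pseudocomplement_def by (simp add: sup_sub)
qed

lemma pseudocomplement_mem: "a \<in> M \<Longrightarrow> pseudocomplement LM a \<in> M"
  by (simp add: pseudocomplement_sub sup_mem)

lemma le_pseudocomplement:
  assumes "a \<in> M" "x \<in> M" "x \<sqinter> a = \<bottom>"
  shows "x \<sqsubseteq> pseudocomplement LM a"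
proof -
  have "x \<sqsubseteq> \<Squnion>{x \<in> M. x \<sqinter> a = \<bottom>}"
    using assms in_carrier by (intro sup_upper) auto
  then show ?thesis
    using assms by (simp add: pseudocomplement_sub)
qed

text \<open>By the infinite distributive law, a join of elements disjoint from \<open>a\<close> is again
  disjoint from \<open>a\<close>; so \<open>a\<^sup>*\<close> is the largest such element and not just an upper bound.\<close>

lemma pseudocomplement_meet:
  assumes a: "a \<in> M"
  shows "pseudocomplement LM a \<sqinter> a = \<bottom>"
proof -
  let ?D = "{x \<in> M. x \<sqinter> a = \<bottom>}"
  have D: "?D \<subseteq> carrier L" using in_carrier by auto
  have "a \<sqinter> \<Squnion>?D = \<Squnion>{a \<sqinter> s | s. s \<in> ?D}"
    using a D in_carrier by (intro meet_sup_distrib)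
  also have "\<dots> \<sqsubseteq> \<bottom>"
    by (intro sup_least) (auto simp: meet_comm)
  finally have "a \<sqinter> \<Squnion>?D = \<bottom>"
    using a D in_carrier by (simp add: le_bottom_eq)
  then show ?thesis
    using a by (simp add: pseudocomplement_sub meet_comm)
qed

end

sublocale topoframe \<subseteq> frame_subframe L \<tau> ..

context topoframe
begin

lemma is_complement_tau: "t \<in> \<tau> \<Longrightarrow> is_complement L t (complement L t)"
  by (simp add: tau_complemented complemented_is_complement)

text \<open>The infimum defining the closure is attained: \<open>a\<^sup>*\<close> is itself disjoint from \<open>a\<close>, and any
  \<open>t \<in> \<tau>\<close> with \<open>a \<sqsubseteq> t'\<close> lies below \<open>a\<^sup>*\<close>, so that \<open>(a\<^sup>*)' \<sqsubseteq> t'\<close>.\<close>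

lemma closure_eq_complement:
  assumes a: "a \<in> \<tau>"
  shows "topoframe_closure L \<tau> a = complement L (pseudocomplement LM a)"
proof -
  let ?p = "pseudocomplement LM a"
  let ?C = "{x \<in> complement L ` \<tau>. a \<sqsubseteq> x}"
  have p: "?p \<in> \<tau>" using a by (rule pseudocomplement_mem)
  have compl: "complement L t \<in> carrier L" if "t \<in> \<tau>" for t
    using is_complement_tau[OF that] by (simp add: is_complement_def)
  have C: "?C \<subseteq> carrier L" using compl by auto
  have "a \<sqsubseteq> complement L ?p"
    by (simp add: le_complement_iff[OF is_complement_tau[OF p]] a in_carrier pseudocomplement_meet)
  then have mem: "complement L ?p \<in> ?C" using p by simp
  have lower: "complement L ?p \<sqsubseteq> x" if "x \<in> ?C" for x
  proof -
    obtain t where t: "t \<in> \<tau>" and x: "x = complement L t" and ax: "a \<sqsubseteq> x" using \<open>x \<in> ?C\<close> by blast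
    have "t \<sqinter> a = \<bottom>"
      using ax by (simp add: x le_complement_iff[OF is_complement_tau[OF t]] a in_carrier)
    then have tp: "t \<sqsubseteq> ?p" by (rule le_pseudocomplement[OF a t])
    have pc: "?p \<sqinter> complement L ?p = \<bottom>"
      using is_complement_tau[OF p] by (simp add: is_complement_def)
    have cs: "t \<in> carrier L" "?p \<in> carrier L" "complement L ?p \<in> carrier L"
      using t p compl in_carrier by auto
    then have "t \<sqinter> complement L ?p \<sqsubseteq> ?p \<sqinter> complement L ?p"
      using tp by (meson le_trans meet_closed meet_le meet_left meet_right)
    then have "t \<sqinter> complement L ?p = \<bottom>"
      using cs by (simp add: pc le_bottom_eq)
    then show ?thesis
      by (simp add: x le_complement_iff[OF is_complement_tau[OF t]] cs)
  qed
  have "\<Sqinter>?C \<sqsubseteq> complement L ?p" using C mem by (rule inf_lower)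
  moreover have "complement L ?p \<sqsubseteq> \<Sqinter>?C"
    using C lower compl[OF p] by (intro inf_greatest)
  ultimately show ?thesis
    unfolding topoframe_closure_def using C compl[OF p] by (intro le_antisym) auto
qed

text \<open>If \<open>b'\<close> is in \<open>\<tau>\<close>, then it is one of the elements whose join is \<open>b\<^sup>*\<close>, and already
  \<open>b' \<squnion> b = \<top>\<close>. Conversely, \<open>b\<^sup>* \<squnion> b = \<top>\<close> makes \<open>b\<^sup>*\<close>, which is
  disjoint from \<open>b\<close>, the complement of \<open>b\<close>.\<close>

lemma pseudocomplement_join_top_iff:
  assumes b: "b \<in> \<tau>"
  shows "pseudocomplement LM b \<squnion> b = \<top> \<longleftrightarrow> complement L b \<in> \<tau>"
proof
  let ?q = "pseudocomplement LM b"
  have q: "?q \<in> \<tau>" using b by (rule pseudocomplement_mem)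
  have cs: "b \<in> carrier L" "?q \<in> carrier L" using b q in_carrier by auto
  {
    assume "?q \<squnion> b = \<top>"
    then have "is_complement L b ?q"
      using cs pseudocomplement_meet[OF b] by (simp add: is_complement_def meet_comm join_comm)
    then show "complement L b \<in> \<tau>" using complement_eq q by simp
  next
    assume c: "complement L b \<in> \<tau>"
    have m: "b \<sqinter> complement L b = \<bottom>" and j: "b \<squnion> complement L b = \<top>"
      using is_complement_tau[OF b] by (auto simp: is_complement_def)
    have "complement L b \<sqsubseteq> ?q"
      using le_pseudocomplement[OF b c] m by (simp add: meet_comm)
    then have "b \<squnion> complement L b \<sqsubseteq> ?q \<squnion> b"
      using cs c in_carrier by (meson join_closed join_le join_left join_right le_trans)
    then show "?q \<squnion> b = \<top>"
      using cs j by (metis join_closed le_antisym top_closed top_higher)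
  }
qed

end

theorem proposition4:
  fixes L :: "('a, 'b) gorder_scheme" and \<tau> :: "'a set"
  assumes "topoframe L \<tau>"
  shows "extremally_disconnected_frame (L\<lparr>carrier := \<tau>\<rparr>) \<longleftrightarrow>
         extremally_disconnected_topoframe L \<tau>"
proof -
  interpret topoframe L \<tau> by (rule assms)
  let ?ps = "pseudocomplement LM"
  have "extremally_disconnected_frame LM \<longleftrightarrow> (\<forall>a\<in>\<tau>. ?ps (?ps a) \<squnion>\<^bsub>LM\<^esub> ?ps a = \<top>\<^bsub>LM\<^esub>)"
    using frame_sub
    by (auto simp: extremally_disconnected_frame_def extremally_disconnected_frame_axioms_def)
  also have "\<dots> \<longleftrightarrow> (\<forall>a\<in>\<tau>. ?ps (?ps a) \<squnion>\<^bsub>L\<^esub> ?ps a = \<top>\<^bsub>L\<^esub>)"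
    by (simp add: join_sub top_sub pseudocomplement_mem)
  also have "\<dots> \<longleftrightarrow> (\<forall>a\<in>\<tau>. topoframe_closure L \<tau> a \<in> \<tau>)"
    by (simp add: pseudocomplement_join_top_iff pseudocomplement_mem closure_eq_complement)
  also have "\<dots> \<longleftrightarrow> extremally_disconnected_topoframe L \<tau>"
    using assms
    by (auto simp: extremally_disconnected_topoframe_def extremally_disconnected_topoframe_axioms_def)
  finally show ?thesis .
qed

end
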